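(* Let $I\subseteq\mathbb{R}$ be an interval with interior $I^{\circ}$, let $f:I\to\mathbb{R}$ be differentiable on $I^{\circ}$ and such that $f'\in L[a,b]$, where $a,b\in I$ with $a<b$. If $|f'|^{q}$ is concave on $[a,b]$ for some fixed $q>1$, then for each $x\in[a,b]$, $$\left|\frac{(b-x)f(b)+(x-a)f(a)}{b-a}-\frac{1}{b-a}\int_a^b f(u)\,du\right|\le \left[\frac{q-1}{2q-1}\right]^{\frac{q-1}{q}}\left[\frac{(x-a)^2\left|f'\left(\frac{a+x}{2}\right)\right|+(b-x)^2\left|f'\left(\frac{b+x}{2}\right)\right|}{b-a}\right].$$
   Context: $f'\in L[a,b]$ means that $f'$ is (Lebesgue) integrable on $[a,b]$.
   Formalization: If a or b is an endpoint of I, f is also assumed one-sidedly differentiable there, so that f' is defined on all of [a,b]; without this the claim fails, e.g. I=[0,1], f(0)=1, f=0 on (0,1], x=1. *)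

theory Defs
  imports "HOL-Analysis.Analysis"
begin

end

theory Submission
  imports Defs
begin

text \<open>Integrating by parts on each of \<open>[a, x]\<close> and \<open>[x, b]\<close>, and rescaling both to \<open>[0, 1]\<close> with
  \<open>x\<close> sent to \<open>0\<close>, the claim becomes a bound for \<open>\<integral> t \<phi>(t) dt\<close> over \<open>[0, 1]\<close>. A supporting line of
  the concave function \<open>\<bar>\<phi>\<bar>\<^sup>q\<close> at \<open>1/2\<close> integrates to \<open>\<bar>\<phi>(1/2)\<bar>\<^sup>q\<close>. Instead of Hoelder's inequality,
  Young's inequality is applied pointwise with the weights that are optimal for the extremal case, so
  that nothing needs to be known about the integrability of \<open>\<bar>\<phi>\<bar>\<^sup>q\<close>.\<close>

text \<open>The function \<open>- g\<close> is convex, so at an interior point the infimum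
  \<open>d\<close> of its difference quotients to the right of \<open>c\<close> is a subgradient;
  \<open>- d\<close> is then a slope for \<open>g\<close>.\<close>

lemma concave_on_supporting_line:
  fixes g :: "real \<Rightarrow> real"
  assumes "concave_on S g" and "c \<in> interior S"
  obtains s where "\<And>t. t \<in> S \<Longrightarrow> g t \<le> g c + s * (t - c)"
proof -
  define d where "d = Inf ((\<lambda>t. (- g c - - g t) / (c - t)) ` ({c<..} \<inter> S))"
  have "g t \<le> g c + (- d) * (t - c)" if "t \<in> S" for t
    using convex_le_Inf_differential[OF assms(1)[unfolded concave_on_def] assms(2) that]
    unfolding d_def by (simp add: algebra_simps)
  with that show ?thesis by blast
qed

lemma concave_on_comp_affine:
  fixes g :: "real \<Rightarrow> real"
  assumes "concave_on S g" and "convex T" and "\<And>t. t \<in> T \<Longrightarrow> c + m * t \<in> S"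
  shows "concave_on T (\<lambda>t. g (c + m * t))"
  unfolding concave_on_iff
proof (intro conjI ballI allI impI assms(2))
  fix s t u v :: real
  assume *: "s \<in> T" "t \<in> T" "u \<ge> 0" "v \<ge> 0" "u + v = 1"
  \<comment> \<open>Since the weights sum to 1, an affine map carries convex combinations to convex
    combinations.\<close>
  have "c + m * (u *\<^sub>R s + v *\<^sub>R t) = (u + v) * c + m * (u * s + v * t)"
    using \<open>u + v = 1\<close> by simp
  also have "\<dots> = u *\<^sub>R (c + m * s) + v *\<^sub>R (c + m * t)"
    by (simp add: algebra_simps)
  finally show "u * g (c + m * s) + v * g (c + m * t) \<le> g (c + m * (u *\<^sub>R s + v *\<^sub>R t))"
    using assms(1) assms(3)[OF *(1)] assms(3)[OF *(2)] * unfolding concave_on_iff by metis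
qed

text \<open>The constant is the L^p norm of t on [0, 1], where p is the exponent conjugate to q. The
  midpoint value dominates the L^q norm of \<phi> because of concavity, so the bound is the one that
  Hoelder's inequality suggests.\<close>

lemma first_moment_bound_concave_powr:
  fixes \<phi> :: "real \<Rightarrow> real"
  assumes q: "q > 1"
    and conc: "concave_on {0..1} (\<lambda>t. \<bar>\<phi> t\<bar> powr q)"
    and int: "(\<lambda>t. t * \<phi> t) integrable_on {0..1}"
  shows "\<bar>integral {0..1} (\<lambda>t. t * \<phi> t)\<bar>
    \<le> ((q - 1) / (2 * q - 1)) powr ((q - 1) / q) * \<bar>\<phi> (1/2)\<bar>"
proof -
  define p where "p = q / (q - 1)"
  define C where "C = ((q - 1) / (2 * q - 1)) powr ((q - 1) / q)"
  define M where "M = \<bar>\<phi> (1/2)\<bar>"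
  have p: "p > 1" "1 / p + 1 / q = 1" "p + 1 = (2 * q - 1) / (q - 1)"
    using q by (auto simp: p_def field_simps)
  have C: "C > 0" using q by (simp add: C_def)
  \<comment> \<open>The exponent of \<open>C\<close> is 1 / p, and 1 / (p + 1) is the integral of
    \<open>t powr p\<close> over [0, 1].\<close>
  have Cp: "C powr p = 1 / (p + 1)"
    using q by (simp add: C_def powr_powr p(3)) (simp add: p_def)
  obtain s where s: "\<And>t. t \<in> {0..1} \<Longrightarrow> \<bar>\<phi> t\<bar> powr q \<le> M powr q + s * (t - 1/2)"
    using concave_on_supporting_line[OF conc, of "1/2"] unfolding M_def by auto
  show ?thesis
  proof (cases "M = 0")
    case True
    \<comment> \<open>Normalising by \<open>M\<close> is impossible here. The supporting line is
      nonnegative at 0 and at 1 but vanishes at 1/2, so its slope is zero and \<phi> vanishes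
      throughout.\<close>
    have "0 \<le> s * (0 - 1/2)" "0 \<le> s * (1 - 1/2)"
      using s[of 0] s[of 1] True q powr_ge_zero[of "\<bar>\<phi> 0\<bar>" q] powr_ge_zero[of "\<bar>\<phi> 1\<bar>" q]
      by (simp_all del: powr_ge_zero)
    then have "s = 0" by simp
    have "\<phi> t = 0" if "t \<in> {0..1}" for t
      using s[OF that] True \<open>s = 0\<close> powr_ge_zero[of "\<bar>\<phi> t\<bar>" q] q by simp
    then have "integral {0..1} (\<lambda>t. t * \<phi> t) = integral {0..1} (\<lambda>t :: real. 0)"
      by (intro Henstock_Kurzweil_Integration.integral_cong) auto
    then show ?thesis by simp
  next
    case False
    then have M: "M > 0" by (simp add: M_def)
    \<comment> \<open>An explicit integrable majorant of \<open>\<bar>t * \<phi> t\<bar>\<close>: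
      Young's bound for t / C and \<open>\<bar>\<phi> t\<bar> / M\<close>, with the q-th power
      replaced by the supporting line, multiplied back by \<open>M * C\<close>. Its two summands
      integrate to 1 / p and 1 / q, up to that factor.\<close>
    define G where "G = (\<lambda>t. M * C * ((p + 1) / p * t powr p
      + (1 + s / M powr q * (t - 1/2)) / q))"
    have "((\<lambda>t. t powr p) has_integral 1 / (p + 1)) {0..1}"
      using has_integral_powr_from_0[of p 1] p by simp
    moreover have "((\<lambda>t. (1 + s / M powr q * (t - 1/2)) / q) has_integral 1 / q) {0..1}"
    proof -
      \<comment> \<open>An antiderivative whose slope term vanishes at both 0 and 1: the line is
        centred at 1/2, so \<open>s\<close> leaves no trace in the integral.\<close>
      define H where "H = (\<lambda>t. (t + s / M powr q * (t\<^sup>2 / 2 - t / 2)) / q)"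
      have "((\<lambda>t. (1 + s / M powr q * (t - 1/2)) / q) has_integral H 1 - H 0) {0..1}"
        unfolding H_def using q M
        by (intro fundamental_theorem_of_calculus)
          (auto intro!: derivative_eq_intros simp flip: has_real_derivative_iff_has_vector_derivative)
      then show ?thesis by (simp add: H_def)
    qed
    ultimately have "(G has_integral M * C * ((p + 1) / p * (1 / (p + 1)) + 1 / q)) {0..1}"
      unfolding G_def by (intro has_integral_mult_right has_integral_add)
    moreover have "(p + 1) / p * (1 / (p + 1)) + 1 / q = 1"
      using p(1,2) by simp
    ultimately have G: "(G has_integral M * C) {0..1}" by simp
    have "norm (t * \<phi> t) \<le> G t" if t: "t \<in> {0..1}" for t
    proof -
      have "(t / C) * (\<bar>\<phi> t\<bar> / M) \<le> (t / C) powr p / p + (\<bar>\<phi> t\<bar> / M) powr q / q"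
        using t C M p q by (intro Youngs_inequality) auto
      also have "(t / C) powr p / p = (p + 1) / p * t powr p"
        using t C by (simp add: powr_divide Cp)
      also have "(\<bar>\<phi> t\<bar> / M) powr q = \<bar>\<phi> t\<bar> powr q / M powr q"
        using M by (simp add: powr_divide)
      also have "\<dots> / q \<le> (M powr q + s * (t - 1/2)) / M powr q / q"
        using s[OF t] q by (intro divide_right_mono) auto
      also have "\<dots> = (1 + s / M powr q * (t - 1/2)) / q"
        using M by (simp add: add_divide_distrib)
      finally have "M * C * ((t / C) * (\<bar>\<phi> t\<bar> / M)) \<le> G t"
        unfolding G_def using M C by (intro mult_left_mono) auto
      then show ?thesis using M C t by (simp add: abs_mult)
    qed
    then have "norm (integral {0..1} (\<lambda>t. t * \<phi> t)) \<le> integral {0..1} G"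
      using G int by (intro Henstock_Kurzweil_Integration.integral_norm_bound_integral) auto
    then show ?thesis
      using integral_unique[OF G] by (simp add: M_def C_def mult.commute)
  qed
qed

text \<open>The parameter runs from \<open>x\<close> to \<open>y\<close> in either order. The
  absolute value of the Jacobian and the unoriented segment let the statement serve both sides of
  \<open>x\<close>.\<close>

lemma has_integral_reparametrize_segment:
  fixes f :: "real \<Rightarrow> real"
  assumes "x \<noteq> y" and "(f has_integral J) (closed_segment x y)"
  shows "((\<lambda>t. f (x + (y - x) * t)) has_integral J / \<bar>y - x\<bar>) {0..1}"
proof -
  have "(\<lambda>u. (1 / (y - x)) *\<^sub>R u + - ((1 / (y - x)) *\<^sub>R x)) ` cbox (min x y) (max x y) = {0..1}"
    using assms(1) unfolding image_affinity_cbox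
    by (cases "x < y") (simp_all flip: diff_divide_distrib)
  moreover have "(f has_integral J) (cbox (min x y) (max x y))"
    using assms(2) by (simp add: closed_segment_eq_real_ivl min_def max_def split: if_splits)
  ultimately show ?thesis
    using has_integral_affinity[of f J "min x y" "max x y" "y - x" x] assms(1)
    by (simp add: add.commute)
qed

text \<open>One half of the final estimate, with \<open>y\<close> to the left or right of
  \<open>x\<close>. One factor \<open>\<bar>y - x\<bar>\<close> comes from rescaling the integral
  and another from the chain rule, whence the square; the parameter 1/2 corresponds to the midpoint
  of the segment.\<close>

lemma endpoint_minus_integral_bound:
  fixes f f' :: "real \<Rightarrow> real"
  assumes q: "q > 1"
    and der: "\<And>u. u \<in> closed_segment x y \<Longrightarrow>
      (f has_real_derivative f' u) (at u within closed_segment x y)"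
    and conc: "concave_on (closed_segment x y) (\<lambda>u. \<bar>f' u\<bar> powr q)"
  shows "\<bar>\<bar>y - x\<bar> * f y - integral (closed_segment x y) f\<bar>
    \<le> ((q - 1) / (2 * q - 1)) powr ((q - 1) / q) * ((y - x)\<^sup>2 * \<bar>f' ((x + y) / 2)\<bar>)"
proof (cases "x = y")
  case False
  define m where "m = y - x"
  define F where "F = (\<lambda>t. f (x + m * t))"
  define \<phi> where "\<phi> = (\<lambda>t. m * f' (x + m * t))"
  have seg: "x + m * t \<in> closed_segment x y" if "t \<in> {0..1}" for t
    using that by (auto simp: in_segment m_def algebra_simps intro!: exI[of _ t])
  have DF: "(F has_real_derivative \<phi> t) (at t within {0..1})" if t: "t \<in> {0..1}" for t
  proof -
    have "(f has_real_derivative f' (x + m * t)) (at (x + m * t) within (\<lambda>t. x + m * t) ` {0..1})"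
      by (rule DERIV_subset[OF der[OF seg[OF t]]]) (use seg in auto)
    moreover have "((\<lambda>t. x + m * t) has_real_derivative m) (at t within {0..1})"
      by (auto intro!: derivative_eq_intros)
    ultimately show ?thesis
      unfolding F_def \<phi>_def using DERIV_image_chain[of f _ "\<lambda>t. x + m * t"]
      by (simp add: o_def mult.commute[of m "f' (x + m * t)"])
  qed
  have "continuous_on {0..1} F"
    using DF by (meson DERIV_continuous continuous_on_eq_continuous_within)
  then have intF: "F integrable_on {0..1}"
    by (rule integrable_continuous_interval)
  \<comment> \<open>The integrand is the derivative of \<open>t * F t\<close>, whose boundary term
    at 0 vanishes. Subtracting the continuous \<open>F\<close> yields both the integrability of
    \<open>t * \<phi> t\<close> and its integral.\<close>
  have "((\<lambda>t. F t + t * \<phi> t) has_integral 1 * F 1 - 0 * F 0) {0..1}"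
    by (intro fundamental_theorem_of_calculus)
      (auto intro!: derivative_eq_intros DF simp flip: has_real_derivative_iff_has_vector_derivative)
  from has_integral_diff[OF this integrable_integral[OF intF]]
  have parts: "((\<lambda>t. t * \<phi> t) has_integral F 1 - integral {0..1} F) {0..1}"
    by simp
  have "concave_on {0..1} (\<lambda>t. \<bar>m\<bar> powr q * \<bar>f' (x + m * t)\<bar> powr q)"
    using concave_on_comp_affine[OF conc, of "{0..1}"] seg by (intro concave_on_cmul) auto
  then have "concave_on {0..1} (\<lambda>t. \<bar>\<phi> t\<bar> powr q)"
    by (simp add: \<phi>_def abs_mult powr_mult)
  note moment = first_moment_bound_concave_powr[OF q this has_integral_integrable[OF parts]]
  have mid: "x + m / 2 = (x + y) / 2"
    by (simp add: m_def field_simps)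
  have B: "\<bar>F 1 - integral {0..1} F\<bar>
      \<le> ((q - 1) / (2 * q - 1)) powr ((q - 1) / q) * (\<bar>m\<bar> * \<bar>f' ((x + y) / 2)\<bar>)"
    using moment unfolding integral_unique[OF parts] by (simp add: \<phi>_def abs_mult mid)
  have "continuous_on (closed_segment x y) f"
    using der by (meson DERIV_continuous continuous_on_eq_continuous_within)
  then have "f integrable_on closed_segment x y"
    by (auto simp: closed_segment_eq_real_ivl intro: integrable_continuous_interval)
  from has_integral_reparametrize_segment[OF False integrable_integral[OF this]]
  have "integral {0..1} F = integral (closed_segment x y) f / \<bar>m\<bar>"
    unfolding F_def m_def by (rule integral_unique)
  \<comment> \<open>Here \<open>F 1\<close> is \<open>f y\<close>, since the parameter 1 corresponds
    to \<open>y\<close>.\<close>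
  then have "\<bar>m\<bar> * f y - integral (closed_segment x y) f = \<bar>m\<bar> * (F 1 - integral {0..1} F)"
    using False by (simp add: F_def m_def field_simps)
  then have "\<bar>\<bar>m\<bar> * f y - integral (closed_segment x y) f\<bar> = \<bar>m\<bar> * \<bar>F 1 - integral {0..1} F\<bar>"
    by (simp add: abs_mult)
  also have "\<dots> \<le> \<bar>m\<bar> * (((q - 1) / (2 * q - 1)) powr ((q - 1) / q) * (\<bar>m\<bar> * \<bar>f' ((x + y) / 2)\<bar>))"
    using B by (intro mult_left_mono) auto
  also have "\<dots> = ((q - 1) / (2 * q - 1)) powr ((q - 1) / q) * (m\<^sup>2 * \<bar>f' ((x + y) / 2)\<bar>)"
    by (simp add: power2_eq_square mult.left_commute[of "\<bar>m\<bar>"] flip: mult.assoc)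
  finally show ?thesis
    by (simp only: m_def)
qed simp

theorem theorem5:
  fixes I :: "real set" and f f' :: "real \<Rightarrow> real" and a b q x :: real
  assumes "is_interval I" and "a \<in> I" and "b \<in> I" and "a < b"
    and "\<And>y. y \<in> interior I \<Longrightarrow> (f has_real_derivative f' y) (at y)"
    and "\<And>y. y \<in> {a, b} \<Longrightarrow> (f has_real_derivative f' y) (at y within I)"
    and "set_integrable lebesgue {a..b} f'"
    and "q > 1"
    and "concave_on {a..b} (\<lambda>y. \<bar>f' y\<bar> powr q)"
    and "x \<in> {a..b}"
  shows "\<bar>((b - x) * f b + (x - a) * f a) / (b - a) - 1 / (b - a) * integral {a..b} f\<bar>
    \<le> ((q - 1) / (2 * q - 1)) powr ((q - 1) / q) *
      (((x - a)\<^sup>2 * \<bar>f' ((a + x) / 2)\<bar> + (b - x)\<^sup>2 * \<bar>f' ((b + x) / 2)\<bar>) / (b - a))"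
proof -
  define C where "C = ((q - 1) / (2 * q - 1)) powr ((q - 1) / q)"
  have sub: "{a..b} \<subseteq> I"
    using mem_is_interval_1_I[OF assms(1-3)] by auto
  \<comment> \<open>The points \<open>a\<close> and \<open>b\<close> may lie on the boundary of
    \<open>I\<close>, where only the derivative within \<open>I\<close> is given; all other points
    of the interval are interior to \<open>I\<close>.\<close>
  have der: "(f has_real_derivative f' u) (at u within {a..b})" if u: "u \<in> {a..b}" for u
  proof (cases "u \<in> {a, b}")
    case True
    then show ?thesis using DERIV_subset[OF assms(6) sub] by simp
  next
    case False
    then have "u \<in> interior I"
      using u interior_mono[OF sub] by auto
    then show ?thesis
      by (rule has_field_derivative_at_within[OF assms(5)])
  qed
  have "continuous_on {a..b} f"
    using der by (meson DERIV_continuous continuous_on_eq_continuous_within)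
  then have "integral {a..x} f + integral {x..b} f = integral {a..b} f"
    using assms(10) by (intro Henstock_Kurzweil_Integration.integral_combine)
      (auto intro: integrable_continuous_interval)
  moreover have half: "\<bar>\<bar>y - x\<bar> * f y - integral (closed_segment x y) f\<bar>
      \<le> C * ((y - x)\<^sup>2 * \<bar>f' ((x + y) / 2)\<bar>)" if "y \<in> {a, b}" for y
  proof -
    have seg: "closed_segment x y \<subseteq> {a..b}"
      using that assms(4,10) by (auto simp: closed_segment_eq_real_ivl)
    show ?thesis
      unfolding C_def
    proof (rule endpoint_minus_integral_bound[OF assms(8)])
      show "(f has_real_derivative f' u) (at u within closed_segment x y)"
        if "u \<in> closed_segment x y" for u
        using DERIV_subset[OF der seg] that seg by blast
      show "concave_on (closed_segment x y) (\<lambda>u. \<bar>f' u\<bar> powr q)"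
        using assms(9) seg unfolding concave_on_def by (rule convex_on_subset) simp
    qed
  qed
  have "\<bar>(x - a) * f a - integral {a..x} f\<bar> \<le> C * ((x - a)\<^sup>2 * \<bar>f' ((a + x) / 2)\<bar>)"
    using half[of a] assms(10)
    by (simp add: closed_segment_eq_real_ivl add.commute power2_commute split: if_splits)
  moreover have "\<bar>(b - x) * f b - integral {x..b} f\<bar> \<le> C * ((b - x)\<^sup>2 * \<bar>f' ((b + x) / 2)\<bar>)"
    using half[of b] assms(10)
    by (simp add: closed_segment_eq_real_ivl add.commute split: if_splits)
  \<comment> \<open>The triangle inequality adds the two halves, whose integrals combine to the one
    over \<open>{a..b}\<close>.\<close>
  ultimately have "\<bar>(b - x) * f b + (x - a) * f a - integral {a..b} f\<bar>
      \<le> C * ((x - a)\<^sup>2 * \<bar>f' ((a + x) / 2)\<bar> + (b - x)\<^sup>2 * \<bar>f' ((b + x) / 2)\<bar>)"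
    by (simp add: distrib_left)
  then have "\<bar>(b - x) * f b + (x - a) * f a - integral {a..b} f\<bar> / (b - a)
      \<le> C * ((x - a)\<^sup>2 * \<bar>f' ((a + x) / 2)\<bar> + (b - x)\<^sup>2 * \<bar>f' ((b + x) / 2)\<bar>) / (b - a)"
    using assms(4) by (intro divide_right_mono) auto
  moreover have "((b - x) * f b + (x - a) * f a) / (b - a) - 1 / (b - a) * integral {a..b} f
      = ((b - x) * f b + (x - a) * f a - integral {a..b} f) / (b - a)"
    by (simp add: diff_divide_distrib)
  ultimately show ?thesis
    using assms(4) by (simp add: C_def abs_divide)
qed

end
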